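(* Given $q>0$, there exist constants $C,c>0$ such that for any $n\in\mathbb N$ and any random vector $X=(X_1,\dots,X_n)\in\mathbb R^n$ with independent entries, $$\forall t\ge 0:\qquad \mathbb P\left(\big|\|X\|-\|X'\|\big|>t\right)\le C\,n\,M'_q\left(\frac{\log^2(1+ct)}{ct}\right)^q,$$ where $X'$ is an independent copy of $X$ and $M'_q=\sup_{i\in\{1,\dots,n\}}\mathbb E\left[(e+|X_i|)^q\right]$.
   Context: $\|\cdot\|$ is the Euclidean norm on $\mathbb R^n$, $\log^2(x)$ means $(\log x)^2$, and $e=\exp(1)$. The constants $C,c$ depend neither on $n$ nor on the law of $X$.
   Formalization: The bound is proved for all t ≥ t_0, for any given t_0 > 0, with C, c depending on q and t_0 only; for all t ≥ 0 it is false, since the right side tends to 0 as t → 0+ (n = 1, X uniform on {0,1}) and is undefined at t = 0. *)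

theory Defs
  imports "HOL-Probability.Probability"
begin

text \<open>Random vectors indexed by \<open>I\<close> are families \<open>X :: 'i \<Rightarrow> 'a \<Rightarrow> real\<close>. The entries of a
  vector and of its independent copy are compared and separated jointly, as one random element of
  the product space, not coordinate by coordinate.\<close>

definition (in prob_space) indep_copy ::
    "'i set \<Rightarrow> ('i \<Rightarrow> 'a \<Rightarrow> real) \<Rightarrow> ('i \<Rightarrow> 'a \<Rightarrow> real) \<Rightarrow> bool" where
  "indep_copy I X X' \<longleftrightarrow>
     indep_var (PiM I (\<lambda>_. borel)) (\<lambda>\<omega>. \<lambda>i\<in>I. X i \<omega>)
               (PiM I (\<lambda>_. borel)) (\<lambda>\<omega>. \<lambda>i\<in>I. X' i \<omega>) \<and>
     distr M (PiM I (\<lambda>_. borel)) (\<lambda>\<omega>. \<lambda>i\<in>I. X' i \<omega>) =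
     distr M (PiM I (\<lambda>_. borel)) (\<lambda>\<omega>. \<lambda>i\<in>I. X i \<omega>)"

text \<open>No moment of the entries is assumed finite, so the supremum is taken in the extended
  nonnegative reals.\<close>

definition sup_moment :: "'a measure \<Rightarrow> real \<Rightarrow> 'i set \<Rightarrow> ('i \<Rightarrow> 'a \<Rightarrow> real) \<Rightarrow> ennreal" where
  "sup_moment M q I X = (SUP i\<in>I. \<integral>\<^sup>+\<omega>. ennreal ((exp 1 + \<bar>X i \<omega>\<bar>) powr q) \<partial>M)"

end

theory Submission
  imports Defs
begin

text \<open>Put \<open>L = t / (ln (1 + t))\<^sup>2\<close>. By Markov's inequality some entry exceeds \<open>L\<close> in absolute value
  with probability at most \<open>n M L\<^bsup>-q\<^esup>\<close>. Otherwise \<open>\<parallel>X\<parallel> = L \<surd>S\<close>, where \<open>S\<close> is the sum of the independent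
  variables \<open>min 1 ((X\<^sub>i / L)\<^sup>2)\<close> with values in \<open>[0, 1]\<close>. Chernoff bounds for \<open>S\<close> with mean
  \<open>\<mu>\<close> show that \<open>\<surd>S\<close> is subgaussian around \<open>\<surd>\<mu>\<close>, uniformly in \<open>\<mu>\<close> and \<open>n\<close>, so \<open>\<parallel>X\<parallel>\<close> is
  within \<open>t / 2\<close> of \<open>L \<surd>\<mu>\<close> up to probability \<open>2 exp (- (t / L)\<^sup>2 / 8) = 2 exp (- (ln (1 + t))\<^sup>4 / 8)\<close>, which
  decays faster than \<open>L\<^bsup>-q\<^esup>\<close>. The vector \<open>X'\<close> has the same law, so its norm is close
  to the same number.\<close>

section \<open>Chernoff bounds for sums of independent variables with values in the unit
  interval\<close>

lemma exp_minus_le_quadratic: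
  fixes x :: real
  assumes "0 \<le> x"
  shows "exp (- x) \<le> 1 - x + x\<^sup>2 / 2"
proof -
  have pos: "0 < 1 - x + x\<^sup>2 / 2"
    using sum_power2_ge_zero[of "x - 1" 0] by (simp add: power2_eq_square algebra_simps)
  \<comment> \<open>The product equals \<open>1 + x^4 / 4\<close>. Its second factor is at most
    \<open>exp x\<close>, and dividing by \<open>exp x\<close> gives the claim.\<close>
  have "1 \<le> (1 - x + x\<^sup>2 / 2) * (1 + x + x\<^sup>2 / 2)"
    using zero_le_even_power[of 4 x] by (simp add: power2_eq_square power4_eq_xxxx algebra_simps)
  also have "\<dots> \<le> (1 - x + x\<^sup>2 / 2) * exp x"
    using pos exp_lower_Taylor_quadratic[OF assms] by (intro mult_left_mono) auto
  finally show ?thesis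
    by (simp add: exp_minus field_simps)
qed

context prob_space
begin

text \<open>Convexity puts \<open>exp (l * z)\<close> below its chord on the unit interval,
  \<open>1 + y \<le> exp y\<close> turns the mean of the chord into an exponential, and independence
  multiplies the factors. The result is the moment generating function of a Poisson variable with
  the same mean; both signs of \<open>l\<close> are covered, as the two tails require.\<close>

lemma nn_integral_exp_sum_le:
  fixes Z :: "'i \<Rightarrow> 'a \<Rightarrow> real"
  assumes I: "finite I" and indep: "indep_vars (\<lambda>_. borel) Z I"
    and Z: "\<And>i \<omega>. i \<in> I \<Longrightarrow> Z i \<omega> \<in> {0..1}"
  shows "(\<integral>\<^sup>+\<omega>. ennreal (exp (l * (\<Sum>i\<in>I. Z i \<omega>))) \<partial>M)
           \<le> ennreal (exp ((exp l - 1) * (\<Sum>i\<in>I. expectation (Z i))))"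
proof -
  have meas: "Z i \<in> borel_measurable M" if "i \<in> I" for i
    using indep that by (auto simp: indep_vars_def)
  have int: "integrable M (Z i)" if "i \<in> I" for i
    using Z[OF that] meas[OF that] by (intro integrable_const_bound[where B = 1]) auto
  have single: "(\<integral>\<^sup>+\<omega>. ennreal (exp (l * Z i \<omega>)) \<partial>M) \<le> ennreal (exp ((exp l - 1) * expectation (Z i)))"
    if i: "i \<in> I" for i
  proof -
    have chord: "exp (l * Z i \<omega>) \<le> 1 + (exp l - 1) * Z i \<omega>" for \<omega>
      using convex_onD[OF exp_convex, of "Z i \<omega>" 0 l] Z[OF i, of \<omega>] by (simp add: algebra_simps)
    have nonneg: "0 \<le> 1 + (exp l - 1) * Z i \<omega>" for \<omega>
      using chord[of \<omega>] exp_gt_zero[of "l * Z i \<omega>"] by linarith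
    have "(\<integral>\<^sup>+\<omega>. ennreal (exp (l * Z i \<omega>)) \<partial>M) \<le> (\<integral>\<^sup>+\<omega>. ennreal (1 + (exp l - 1) * Z i \<omega>) \<partial>M)"
      by (intro nn_integral_mono ennreal_leI chord)
    also have "\<dots> = ennreal (expectation (\<lambda>\<omega>. 1 + (exp l - 1) * Z i \<omega>))"
      using int[OF i] nonneg by (intro nn_integral_eq_integral) auto
    also have "expectation (\<lambda>\<omega>. 1 + (exp l - 1) * Z i \<omega>) = 1 + (exp l - 1) * expectation (Z i)"
      using int[OF i] by (simp add: prob_space)
    also have "ennreal \<dots> \<le> ennreal (exp ((exp l - 1) * expectation (Z i)))"
      by (intro ennreal_leI exp_ge_add_one_self)
    finally show ?thesis .
  qed
  have "(\<integral>\<^sup>+\<omega>. ennreal (exp (l * (\<Sum>i\<in>I. Z i \<omega>))) \<partial>M)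
        = (\<integral>\<^sup>+\<omega>. (\<Prod>i\<in>I. ennreal (exp (l * Z i \<omega>))) \<partial>M)"
    by (intro nn_integral_cong) (simp add: sum_distrib_left exp_sum I prod_ennreal)
  also have "\<dots> = (\<Prod>i\<in>I. \<integral>\<^sup>+\<omega>. ennreal (exp (l * Z i \<omega>)) \<partial>M)"
    by (intro indep_vars_nn_integral I indep_vars_compose2[OF indep]) auto
  also have "\<dots> \<le> (\<Prod>i\<in>I. ennreal (exp ((exp l - 1) * expectation (Z i))))"
    by (intro prod_mono_ennreal single)
  also have "\<dots> = ennreal (exp ((exp l - 1) * (\<Sum>i\<in>I. expectation (Z i))))"
    by (simp add: prod_ennreal sum_distrib_left exp_sum I)
  finally show ?thesis .
qed

text \<open>The variance of the sum is at most its mean, so the square root fluctuates on a scale of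
  order 1 whatever the mean and the number of terms. Each tail is a Chernoff bound for the sum at
  the squared threshold.\<close>

lemma sqrt_sum_concentration:
  fixes Z :: "'i \<Rightarrow> 'a \<Rightarrow> real"
  assumes I: "finite I" and indep: "indep_vars (\<lambda>_. borel) Z I"
    and Z: "\<And>i \<omega>. i \<in> I \<Longrightarrow> Z i \<omega> \<in> {0..1}" and u: "u > 0"
  shows "emeasure M {\<omega> \<in> space M. \<bar>sqrt (\<Sum>i\<in>I. Z i \<omega>) - sqrt (\<Sum>i\<in>I. expectation (Z i))\<bar> > u}
           \<le> ennreal (2 * exp (- u\<^sup>2 / 2))"
proof -
  define S where "S = (\<lambda>\<omega>. \<Sum>i\<in>I. Z i \<omega>)"
  define \<mu> where "\<mu> = (\<Sum>i\<in>I. expectation (Z i))"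
  define r where "r = sqrt \<mu>"
  have meas: "Z i \<in> borel_measurable M" if "i \<in> I" for i
    using indep that by (auto simp: indep_vars_def)
  then have [measurable]: "S \<in> borel_measurable M"
    unfolding S_def by (intro borel_measurable_sum)
  have S0: "S \<omega> \<ge> 0" for \<omega>
    unfolding S_def using Z by (intro sum_nonneg) auto
  have \<mu>0: "\<mu> \<ge> 0"
    unfolding \<mu>_def using Z by (intro sum_nonneg integral_nonneg) auto
  then have r0: "r \<ge> 0" and r2: "r\<^sup>2 = \<mu>"
    by (auto simp: r_def)
  have mgf: "(\<integral>\<^sup>+\<omega>. ennreal (exp (l * S \<omega>)) \<partial>M) \<le> ennreal (exp ((exp l - 1) * r\<^sup>2))" for l
    using nn_integral_exp_sum_le[OF I indep Z] by (simp add: S_def \<mu>_def r2)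
  have space: "(\<integral>\<^sup>+x\<in>space M. f x \<partial>M) = (\<integral>\<^sup>+x. f x \<partial>M)" for f
    by (intro nn_integral_cong) auto

  have upper: "emeasure M {\<omega> \<in> space M. S \<omega> \<ge> (r + u)\<^sup>2} \<le> ennreal (exp (- u\<^sup>2 / 2))"
  proof -
    \<comment> \<open>This choice gives \<open>l * (r + u) = u\<close>, and \<open>l \<le> 1\<close>
      allows \<open>exp l \<le> 1 + l + l^2\<close>. The exponent is then at most
      \<open>- u * (r + u) + u * r\<close>, that is, minus the square of \<open>u\<close>.\<close>
    define l where "l = u / (r + u)"
    have l: "0 < l" "l \<le> 1"
      using u r0 by (auto simp: l_def)
    have lr: "l * (r + u) = u"
      using u r0 by (simp add: l_def)
    then have lru: "l * r \<le> u"
      using mult_pos_pos[OF l(1) u] by (simp add: distrib_left)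
    have "emeasure M {\<omega> \<in> space M. S \<omega> \<ge> (r + u)\<^sup>2}
        \<le> ennreal (exp (- l * (r + u)\<^sup>2)) * (\<integral>\<^sup>+\<omega>. ennreal (exp (l * S \<omega>)) \<partial>M)"
      using Chernoff_ineq_nn_integral_ge[of l "space M" M S "(r + u)\<^sup>2"] l by (simp add: space)
    also have "\<dots> \<le> ennreal (exp (- l * (r + u)\<^sup>2)) * ennreal (exp ((exp l - 1) * r\<^sup>2))"
      by (intro mult_left_mono mgf) auto
    also have "\<dots> = ennreal (exp (- l * (r + u)\<^sup>2 + (exp l - 1) * r\<^sup>2))"
      by (subst exp_add) (simp add: ennreal_mult')
    also have "\<dots> \<le> ennreal (exp (- u\<^sup>2 / 2))"
    proof (intro ennreal_leI exp_le_cancel_iff[THEN iffD2])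
      have "(exp l - 1) * r\<^sup>2 \<le> (l + l\<^sup>2) * r\<^sup>2"
        using exp_bound[of l] l by (intro mult_right_mono) auto
      also have "\<dots> = (l * r) * r + (l * r) * (l * r)"
        by (simp add: power2_eq_square algebra_simps)
      also have "\<dots> \<le> (l * r) * r + (l * r) * u"
        using l r0 lru by (intro add_left_mono mult_left_mono) simp_all
      also have "\<dots> = (l * (r + u)) * r"
        by (simp add: algebra_simps)
      finally have "(exp l - 1) * r\<^sup>2 \<le> u * r"
        unfolding lr .
      moreover have "- l * (r + u)\<^sup>2 = - (u * r) - u\<^sup>2"
      proof -
        have "l * (r + u)\<^sup>2 = (l * (r + u)) * (r + u)"
          by (simp only: power2_eq_square mult.assoc)
        then show ?thesis
          unfolding lr by (simp add: power2_eq_square distrib_left)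
      qed
      ultimately show "- l * (r + u)\<^sup>2 + (exp l - 1) * r\<^sup>2 \<le> - u\<^sup>2 / 2"
        using zero_le_power2[of u] by linarith
    qed
    finally show ?thesis .
  qed

  \<comment> \<open>For \<open>u > r\<close> a downward deviation is impossible, because the square
    root is nonnegative.\<close>
  have lower: "emeasure M {\<omega> \<in> space M. S \<omega> \<le> (r - u)\<^sup>2} \<le> ennreal (exp (- u\<^sup>2 / 2))"
    if ur: "u \<le> r"
  proof -
    \<comment> \<open>With \<open>l * r = u\<close> the quadratic bound on \<open>exp (- l)\<close>
      makes the exponent at most \<open>l * u^2 - 2 * u^2 + u^2 / 2\<close>, and
      \<open>l \<le> 1\<close> finishes.\<close>
    define l where "l = u / r"
    have l: "0 < l" "l \<le> 1"
      using u ur by (auto simp: l_def)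
    have lr: "l * r = u"
      using u ur by (simp add: l_def)
    have "emeasure M {\<omega> \<in> space M. S \<omega> \<le> (r - u)\<^sup>2}
        \<le> ennreal (exp (l * (r - u)\<^sup>2)) * (\<integral>\<^sup>+\<omega>. ennreal (exp (- l * S \<omega>)) \<partial>M)"
      using Chernoff_ineq_nn_integral_le[of l "space M" M S "(r - u)\<^sup>2"] l by (simp add: space)
    also have "\<dots> \<le> ennreal (exp (l * (r - u)\<^sup>2)) * ennreal (exp ((exp (- l) - 1) * r\<^sup>2))"
      by (intro mult_left_mono mgf) auto
    also have "\<dots> = ennreal (exp (l * (r - u)\<^sup>2 + (exp (- l) - 1) * r\<^sup>2))"
      by (subst exp_add) (simp add: ennreal_mult')
    also have "\<dots> \<le> ennreal (exp (- u\<^sup>2 / 2))"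
    proof (intro ennreal_leI exp_le_cancel_iff[THEN iffD2])
      have "(exp (- l) - 1) * r\<^sup>2 \<le> (- l + l\<^sup>2 / 2) * r\<^sup>2"
        using exp_minus_le_quadratic[of l] l by (intro mult_right_mono) auto
      moreover have "l * (r - u)\<^sup>2 + (- l + l\<^sup>2 / 2) * r\<^sup>2 = l * u\<^sup>2 - 2 * (l * r) * u + (l * r)\<^sup>2 / 2"
        by (simp add: power2_eq_square algebra_simps)
      moreover have "l * u\<^sup>2 \<le> u\<^sup>2"
        using l by (simp add: mult_left_le_one_le)
      ultimately show "l * (r - u)\<^sup>2 + (exp (- l) - 1) * r\<^sup>2 \<le> - u\<^sup>2 / 2"
        unfolding lr by (simp add: power2_eq_square)
    qed
    finally show ?thesis .
  qed

  have "S \<omega> \<ge> (r + u)\<^sup>2 \<or> u \<le> r \<and> S \<omega> \<le> (r - u)\<^sup>2" if "\<bar>sqrt (S \<omega>) - r\<bar> > u" for \<omega>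
  proof (cases "sqrt (S \<omega>) > r + u")
    case True
    then show ?thesis
      using power_mono[of "r + u" "sqrt (S \<omega>)" 2] r0 u S0[of \<omega>] by simp
  next
    case False
    then have *: "sqrt (S \<omega>) < r - u"
      using that by linarith
    moreover have "u \<le> r"
      using * real_sqrt_ge_zero[OF S0[of \<omega>]] by linarith
    ultimately show ?thesis
      using power_mono[of "sqrt (S \<omega>)" "r - u" 2] S0[of \<omega>] by simp
  qed
  then have "{\<omega> \<in> space M. \<bar>sqrt (S \<omega>) - r\<bar> > u}
      \<subseteq> {\<omega> \<in> space M. S \<omega> \<ge> (r + u)\<^sup>2} \<union> {\<omega> \<in> space M. u \<le> r \<and> S \<omega> \<le> (r - u)\<^sup>2}"
    by auto
  then have "emeasure M {\<omega> \<in> space M. \<bar>sqrt (S \<omega>) - r\<bar> > u}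
      \<le> emeasure M ({\<omega> \<in> space M. S \<omega> \<ge> (r + u)\<^sup>2} \<union> {\<omega> \<in> space M. u \<le> r \<and> S \<omega> \<le> (r - u)\<^sup>2})"
    by (intro emeasure_mono) auto
  also have "\<dots> \<le> emeasure M {\<omega> \<in> space M. S \<omega> \<ge> (r + u)\<^sup>2}
      + emeasure M {\<omega> \<in> space M. u \<le> r \<and> S \<omega> \<le> (r - u)\<^sup>2}"
    by (intro emeasure_subadditive) auto
  \<comment> \<open>When \<open>u > r\<close> the second set is empty.\<close>
  also have "\<dots> \<le> ennreal (exp (- u\<^sup>2 / 2)) + ennreal (exp (- u\<^sup>2 / 2))"
    using lower by (intro add_mono upper) (cases "u \<le> r"; simp)
  also have "\<dots> = ennreal (2 * exp (- u\<^sup>2 / 2))"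
    by (simp flip: ennreal_plus)
  finally show ?thesis
    by (simp add: S_def r_def \<mu>_def)
qed

section \<open>Markov's inequality and truncation at level \<open>L\<close>\<close>

lemma emeasure_abs_gt_le_moment:
  fixes Y :: "'a \<Rightarrow> real"
  assumes [measurable]: "Y \<in> borel_measurable M" and L: "L > 0" and q: "q > 0"
  shows "emeasure M {\<omega> \<in> space M. \<bar>Y \<omega>\<bar> > L}
           \<le> ennreal (L powr - q) * (\<integral>\<^sup>+\<omega>. ennreal ((exp 1 + \<bar>Y \<omega>\<bar>) powr q) \<partial>M)"
proof -
  have "emeasure M {\<omega> \<in> space M. \<bar>Y \<omega>\<bar> > L} = (\<integral>\<^sup>+\<omega>. indicator {\<omega> \<in> space M. \<bar>Y \<omega>\<bar> > L} \<omega> \<partial>M)"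
    by simp
  also have "\<dots> \<le> (\<integral>\<^sup>+\<omega>. ennreal (L powr - q) * ennreal ((exp 1 + \<bar>Y \<omega>\<bar>) powr q) \<partial>M)"
  proof (intro nn_integral_mono)
    fix \<omega>
    have "1 \<le> L powr - q * (exp 1 + \<bar>Y \<omega>\<bar>) powr q" if "\<bar>Y \<omega>\<bar> > L"
    proof -
      have "L powr q \<le> (exp 1 + \<bar>Y \<omega>\<bar>) powr q"
        using that L q exp_gt_zero[of "1 :: real"] by (intro powr_mono2) linarith+
      then show ?thesis
        using L by (simp add: powr_minus field_simps)
    qed
    then show "indicator {\<omega> \<in> space M. \<bar>Y \<omega>\<bar> > L} \<omega>
        \<le> ennreal (L powr - q) * ennreal ((exp 1 + \<bar>Y \<omega>\<bar>) powr q)"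
      by (auto simp: indicator_def ennreal_mult' [symmetric] simp flip: ennreal_1 intro!: ennreal_leI)
  qed
  also have "\<dots> = ennreal (L powr - q) * (\<integral>\<^sup>+\<omega>. ennreal ((exp 1 + \<bar>Y \<omega>\<bar>) powr q) \<partial>M)"
    by (intro nn_integral_cmult) measurable
  finally show ?thesis .
qed

text \<open>Truncation at \<open>L\<close> costs a union bound over the entries and leaves a sum to
  which the Chernoff bound applies. The value of the centre \<open>m\<close> does not matter later;
  what matters is that it is a fixed number, against which the norm of the copy can be compared as
  well.\<close>

lemma L2_set_concentration:
  fixes X :: "'i \<Rightarrow> 'a \<Rightarrow> real"
  assumes I: "finite I" and indep: "indep_vars (\<lambda>_. borel) X I"
    and L: "L > 0" and q: "q > 0" and s: "s > 0"
  shows "\<exists>m. emeasure M {\<omega> \<in> space M. \<bar>L2_set (\<lambda>i. X i \<omega>) I - m\<bar> > s}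
           \<le> of_nat (card I) * (ennreal (L powr - q) * sup_moment M q I X)
              + ennreal (2 * exp (- (s / L)\<^sup>2 / 2))"
proof
  \<comment> \<open>The cap keeps the values in the unit interval and the expectations finite
    without any moment assumption; it is inactive when no entry exceeds \<open>L\<close> in absolute
    value.\<close>
  define Z where "Z = (\<lambda>i \<omega>. min 1 ((X i \<omega> / L)\<^sup>2))"
  define m where "m = L * sqrt (\<Sum>i\<in>I. expectation (Z i))"
  have meas [measurable]: "X i \<in> borel_measurable M" if "i \<in> I" for i
    using indep that by (auto simp: indep_vars_def)
  have indepZ: "indep_vars (\<lambda>_. borel) Z I"
    unfolding Z_def by (rule indep_vars_compose2[OF indep]) measurable
  have measZ [measurable]: "Z i \<in> borel_measurable M" if "i \<in> I" for i
    using indepZ that by (auto simp: indep_vars_def)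
  define A where "A = (\<lambda>i. {\<omega> \<in> space M. \<bar>X i \<omega>\<bar> > L})"
  define B where "B = {\<omega> \<in> space M. \<bar>sqrt (\<Sum>i\<in>I. Z i \<omega>) - sqrt (\<Sum>i\<in>I. expectation (Z i))\<bar> > s / L}"
  have [measurable]: "A i \<in> sets M" if "i \<in> I" for i
    unfolding A_def using that by measurable
  have [measurable]: "B \<in> sets M"
    unfolding B_def by measurable
  have "\<omega> \<in> (\<Union>i\<in>I. A i) \<union> B"
    if \<omega>: "\<omega> \<in> space M" "\<bar>L2_set (\<lambda>i. X i \<omega>) I - m\<bar> > s" for \<omega>
  proof (cases "\<forall>i\<in>I. \<bar>X i \<omega>\<bar> \<le> L")
    case True
    have "Z i \<omega> = (X i \<omega>)\<^sup>2 / L\<^sup>2" if "i \<in> I" for i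
    proof -
      have "(X i \<omega>)\<^sup>2 \<le> L\<^sup>2"
        using True that by (simp add: abs_le_square_iff[symmetric]) (use L in auto)
      then show ?thesis
        using L by (simp add: Z_def power_divide min_def)
    qed
    then have "(\<Sum>i\<in>I. Z i \<omega>) = (\<Sum>i\<in>I. (X i \<omega>)\<^sup>2) / L\<^sup>2"
      by (simp add: sum_divide_distrib)
    then have "L2_set (\<lambda>i. X i \<omega>) I = L * sqrt (\<Sum>i\<in>I. Z i \<omega>)"
      using L by (simp add: L2_set_def real_sqrt_divide)
    then have "L * \<bar>sqrt (\<Sum>i\<in>I. Z i \<omega>) - sqrt (\<Sum>i\<in>I. expectation (Z i))\<bar> > s"
      using \<omega>(2) L unfolding m_def by (simp add: abs_mult flip: right_diff_distrib)
    then show ?thesis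
      using \<omega>(1) L by (simp add: B_def field_simps)
  qed (use \<omega> in \<open>auto simp: A_def not_le\<close>)
  then have "emeasure M {\<omega> \<in> space M. \<bar>L2_set (\<lambda>i. X i \<omega>) I - m\<bar> > s} \<le> emeasure M ((\<Union>i\<in>I. A i) \<union> B)"
    using I by (intro emeasure_mono) (auto intro!: sets.finite_UN)
  also have "\<dots> \<le> emeasure M (\<Union>i\<in>I. A i) + emeasure M B"
    using I by (intro emeasure_subadditive) (auto intro!: sets.finite_UN)
  also have "\<dots> \<le> (\<Sum>i\<in>I. emeasure M (A i)) + emeasure M B"
    using I by (intro add_right_mono emeasure_subadditive_finite) auto
  also have "\<dots> \<le> of_nat (card I) * (ennreal (L powr - q) * sup_moment M q I X)
              + ennreal (2 * exp (- (s / L)\<^sup>2 / 2))"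
  proof (intro add_mono sum_bounded_above)
    fix i assume i: "i \<in> I"
    show "emeasure M (A i) \<le> ennreal (L powr - q) * sup_moment M q I X"
      unfolding A_def sup_moment_def
      using emeasure_abs_gt_le_moment[OF meas[OF i] L q]
      by (rule order_trans) (intro mult_left_mono SUP_upper i zero_le)
  next
    show "emeasure M B \<le> ennreal (2 * exp (- (s / L)\<^sup>2 / 2))"
      unfolding B_def using L s
      by (intro sqrt_sum_concentration I indepZ) (auto simp: Z_def)
  qed
  finally show "emeasure M {\<omega> \<in> space M. \<bar>L2_set (\<lambda>i. X i \<omega>) I - m\<bar> > s}
           \<le> of_nat (card I) * (ennreal (L powr - q) * sup_moment M q I X)
              + ennreal (2 * exp (- (s / L)\<^sup>2 / 2))" .
qed

section \<open>Transfer to the independent copy, measurability, and a lower bound on the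
  moment\<close>

lemma emeasure_L2_set_indep_copy:
  fixes X X' :: "'i \<Rightarrow> 'a \<Rightarrow> real"
  assumes copy: "indep_copy I X X'" and [measurable]: "B \<in> sets borel"
  shows "emeasure M {\<omega> \<in> space M. L2_set (\<lambda>i. X' i \<omega>) I \<in> B}
           = emeasure M {\<omega> \<in> space M. L2_set (\<lambda>i. X i \<omega>) I \<in> B}"
proof -
  let ?P = "PiM I (\<lambda>_. borel :: real measure)"
  \<comment> \<open>The norm depends on the entries in \<open>I\<close> alone, so the event is the
    preimage of \<open>D\<close> under the restricted vector, and equality of the joint laws
    applies.\<close>
  define D where "D = {x \<in> space ?P. L2_set x I \<in> B}"
  have [measurable]: "D \<in> sets ?P"
    unfolding D_def L2_set_def by measurable
  have iv: "indep_var ?P (\<lambda>\<omega>. \<lambda>i\<in>I. X i \<omega>) ?P (\<lambda>\<omega>. \<lambda>i\<in>I. X' i \<omega>)"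
    and eq: "distr M ?P (\<lambda>\<omega>. \<lambda>i\<in>I. X' i \<omega>) = distr M ?P (\<lambda>\<omega>. \<lambda>i\<in>I. X i \<omega>)"
    using copy by (auto simp: indep_copy_def)
  have "emeasure (distr M ?P (\<lambda>\<omega>. \<lambda>i\<in>I. Y i \<omega>)) D = emeasure M {\<omega> \<in> space M. L2_set (\<lambda>i. Y i \<omega>) I \<in> B}"
    if Y: "(\<lambda>\<omega>. \<lambda>i\<in>I. Y i \<omega>) \<in> measurable M ?P" for Y
    using measurable_space[OF Y]
    by (subst emeasure_distr[OF Y])
      (auto simp: D_def L2_set_def intro!: arg_cong[where f = "emeasure M"])
  from this[OF indep_var_rv1[OF iv]] this[OF indep_var_rv2[OF iv]] eq show ?thesis
    by simp
qed

text \<open>The definition speaks of the vectors as random elements of the product space; projecting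
  to a coordinate recovers the measurability of each entry.\<close>

lemma indep_copy_measurable:
  fixes X X' :: "'i \<Rightarrow> 'a \<Rightarrow> real"
  assumes "indep_copy I X X'" and "i \<in> I"
  shows "X i \<in> borel_measurable M" and "X' i \<in> borel_measurable M"
proof -
  have *: "Y i \<in> borel_measurable M"
    if "(\<lambda>\<omega>. \<lambda>i\<in>I. Y i \<omega>) \<in> measurable M (PiM I (\<lambda>_. borel :: real measure))" for Y
    using measurable_compose[OF that measurable_component_singleton[OF assms(2)]] assms(2) by simp
  have "indep_var (PiM I (\<lambda>_. borel)) (\<lambda>\<omega>. \<lambda>i\<in>I. X i \<omega>) (PiM I (\<lambda>_. borel)) (\<lambda>\<omega>. \<lambda>i\<in>I. X' i \<omega>)"
    using assms(1) by (simp add: indep_copy_def)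
  then show "X i \<in> borel_measurable M" "X' i \<in> borel_measurable M"
    by (blast intro: * indep_var_rv1 indep_var_rv2)+
qed

text \<open>The integrand is at least 1 since its base is at least \<open>exp 1\<close>. This lets
  the moment factor absorb the Chernoff term, which carries no such factor.\<close>

lemma one_le_sup_moment:
  assumes "i \<in> I" and "q > 0"
  shows "1 \<le> sup_moment M q I X"
proof -
  have "(1 :: real) \<le> (exp 1 + \<bar>x\<bar>) powr q" for x :: real
    using assms(2) one_le_exp_iff[of "1 :: real"] abs_ge_zero[of x]
    by (intro ge_one_powr_ge_zero) linarith+
  then have "(\<integral>\<^sup>+\<omega>. 1 \<partial>M) \<le> (\<integral>\<^sup>+\<omega>. ennreal ((exp 1 + \<bar>X i \<omega>\<bar>) powr q) \<partial>M)"
    by (intro nn_integral_mono) (simp flip: ennreal_1 add: ennreal_leI)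
  then show ?thesis
    unfolding sup_moment_def using assms(1) by (auto simp: emeasure_space_1 intro: SUP_upper2)
qed

end

section \<open>Absorbing the Chernoff term into the polynomial tail\<close>

lemma exp_ln_power4_le:
  fixes q t t0 :: real
  assumes q: "q > 0" and t0: "t0 > 0" and t: "t \<ge> t0"
  shows "exp (- ((ln (1 + t)) ^ 4 / 8))
           \<le> exp (2 + q\<^sup>2 / 4) * ln (1 + t0) powr (- 2 * q) * ((ln (1 + t))\<^sup>2 / t) powr q"
proof -
  define s where "s = ln (1 + t)"
  define s0 where "s0 = ln (1 + t0)"
  have s: "s \<ge> s0" "s0 > 0"
    using t t0 by (auto simp: s_def s0_def)
  \<comment> \<open>The first square gives \<open>s^4 / 8 \<ge> s^2 - 2\<close>, the second
    \<open>s^2 \<ge> q * s - q^2 / 4\<close>; chained, they trade the quartic for a linear term, and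
    \<open>exp (- q * s)\<close> is at most \<open>t powr - q\<close>.\<close>
  have "0 \<le> (s\<^sup>2 - 4)\<^sup>2" and "0 \<le> (s - q / 2)\<^sup>2"
    by simp_all
  then have exponent: "- (s ^ 4 / 8) \<le> 2 + q\<^sup>2 / 4 - q * s"
    by (simp add: power2_eq_square power4_eq_xxxx field_simps)
  have t_le: "t powr q \<le> exp (q * s)"
  proof -
    have "t powr q \<le> (1 + t) powr q"
      using t t0 q by (intro powr_mono2) auto
    then show ?thesis
      using t t0 by (simp add: powr_def s_def)
  qed
  have "exp (- (s ^ 4 / 8)) \<le> exp (2 + q\<^sup>2 / 4) * exp (- (q * s))"
    using exponent by (simp flip: exp_add)
  also have "\<dots> \<le> exp (2 + q\<^sup>2 / 4) * t powr - q"
    using t_le t t0 by (simp add: exp_minus powr_minus le_imp_inverse_le)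
  \<comment> \<open>The inserted powers of \<open>s0\<close> cancel. They are there so that
    \<open>s0 \<le> s\<close> can then produce the logarithm in the numerator; this is where the
    constant acquires its dependence on \<open>t0\<close>.\<close>
  also have "\<dots> = exp (2 + q\<^sup>2 / 4) * s0 powr (- 2 * q) * (s0\<^sup>2 / t) powr q"
  proof -
    have "s0 powr (- 2 * q) * (s0\<^sup>2 / t) powr q = s0 powr (- 2 * q) * (s0 powr (2 * q) * t powr - q)"
      using s t t0 by (simp add: powr_divide powr_minus_divide powr_powr flip: powr_numeral)
    also have "\<dots> = (s0 powr (- 2 * q) * s0 powr (2 * q)) * t powr - q"
      by (simp only: mult.assoc)
    also have "\<dots> = t powr - q"
      using s by (simp flip: powr_add)
    finally show ?thesis
      by (simp only: mult.assoc)
  qed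
  also have "\<dots> \<le> exp (2 + q\<^sup>2 / 4) * s0 powr (- 2 * q) * (s\<^sup>2 / t) powr q"
    using s t t0 q by (intro mult_left_mono powr_mono2 divide_right_mono power_mono) auto
  finally show ?thesis
    by (simp add: s_def s0_def)
qed

text \<open>The range is \<open>t \<ge> t\<^sub>0\<close>, and \<open>C\<close> may depend on
  \<open>t\<^sub>0\<close>: as \<open>t\<close> tends to 0 the right-hand side tends to 0 for fixed
  finite moments, while the probability need not. For one entry uniform on 0 and 1 it is 1/2 for all
  \<open>t\<close> below 1, so no pair of constants serves all \<open>t \<ge> 0\<close>.\<close>

theorem theorem0p2:
  fixes q t\<^sub>0 :: real
  assumes "q > 0" and "t\<^sub>0 > 0"
  shows "\<exists>C>0. \<exists>c>0. \<forall>(n::nat) (M :: 'a measure) (X :: nat \<Rightarrow> 'a \<Rightarrow> real) (X' :: nat \<Rightarrow> 'a \<Rightarrow> real).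
           prob_space M \<longrightarrow>
           prob_space.indep_vars M (\<lambda>_. borel) X {1..n} \<longrightarrow>
           prob_space.indep_copy M {1..n} X X' \<longrightarrow>
           (\<forall>t::real. t \<ge> t\<^sub>0 \<longrightarrow>
              emeasure M {\<omega> \<in> space M.
                \<bar>L2_set (\<lambda>i. X i \<omega>) {1..n} - L2_set (\<lambda>i. X' i \<omega>) {1..n}\<bar> > t}
              \<le> ennreal C * of_nat n * sup_moment M q {1..n} X *
                 ennreal (((ln (1 + c * t))\<^sup>2 / (c * t)) powr q))"
proof -
  define K where "K = exp (2 + q\<^sup>2 / 4) * ln (1 + t\<^sub>0) powr (- 2 * q)"
  have K: "K \<ge> 0"
    by (simp add: K_def)
  have bound: "emeasure M {\<omega> \<in> space M.
        \<bar>L2_set (\<lambda>i. X i \<omega>) {1..n} - L2_set (\<lambda>i. X' i \<omega>) {1..n}\<bar> > t}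
      \<le> ennreal (2 + 4 * K) * of_nat n * sup_moment M q {1..n} X * ennreal (((ln (1 + t))\<^sup>2 / t) powr q)"
    if "prob_space M" and indep: "prob_space.indep_vars M (\<lambda>_. borel) X {1..n}"
      and copy: "prob_space.indep_copy M {1..n} X X'" and t: "t \<ge> t\<^sub>0"
    for n t and M :: "'a measure" and X X' :: "nat \<Rightarrow> 'a \<Rightarrow> real"
  proof (cases "n = 0")
    \<comment> \<open>Both norms vanish and \<open>t\<close> is positive, so the event is empty.
      This case is separate because \<open>W\<close> below is then 0, not at least 1.\<close>
    case True
    then show ?thesis
      using t assms by simp
  next
    case False
    interpret prob_space M by fact
    define F where "F = ((ln (1 + t))\<^sup>2 / t) powr q"
    \<comment> \<open>The level is chosen so that \<open>L powr - q\<close> is exactly the target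
      \<open>F\<close>, while \<open>t / 2 / L\<close> is half the squared logarithm, hence the
      quartic exponent.\<close>
    define L where "L = t / (ln (1 + t))\<^sup>2"
    define W where "W = of_nat n * sup_moment M q {1..n} X"
    have t0: "t > 0"
      using t assms by simp
    then have ln0: "ln (1 + t) > 0"
      by simp
    then have L: "L > 0"
      using t0 by (simp add: L_def)
    have LF: "L powr - q = F"
      using t0 ln0 by (simp add: L_def F_def powr_divide powr_minus)
    have exponent: "- (t / 2 / L)\<^sup>2 / 2 = - ((ln (1 + t)) ^ 4 / 8)"
      using t0 by (simp add: L_def power_divide flip: power_mult)
    have W: "1 \<le> W"
    proof -
      have "1 \<le> sup_moment M q {1..n} X"
        using False assms by (intro one_le_sup_moment[of 1]) auto
      moreover have "(1 :: ennreal) \<le> of_nat n"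
        using False of_nat_mono[of 1 n, where ?'a = ennreal] by simp
      ultimately show ?thesis
        unfolding W_def using mult_mono[of "1 :: ennreal" "of_nat n" 1 "sup_moment M q {1..n} X"] by simp
    qed
    obtain m where m: "emeasure M {\<omega> \<in> space M. \<bar>L2_set (\<lambda>i. X i \<omega>) {1..n} - m\<bar> > t / 2}
        \<le> W * ennreal F + ennreal (2 * exp (- ((ln (1 + t)) ^ 4 / 8)))"
      using L2_set_concentration[of "{1..n}" X L q "t / 2"] indep L assms t0
      unfolding exponent LF W_def by (auto simp: mult_ac)
    \<comment> \<open>The Chernoff term is at most \<open>2 * K * F\<close>, and
      \<open>1 \<le> W\<close> supplies the factors \<open>n\<close> and the moment.\<close>
    have "ennreal (2 * exp (- ((ln (1 + t)) ^ 4 / 8))) \<le> ennreal (2 * K * F)"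
      using exp_ln_power4_le[OF assms t] by (intro ennreal_leI) (simp add: K_def F_def)
    also have "\<dots> \<le> W * ennreal (2 * K * F)"
      using mult_right_mono[OF W, of "ennreal (2 * K * F)"] by simp
    finally have m': "emeasure M {\<omega> \<in> space M. \<bar>L2_set (\<lambda>i. X i \<omega>) {1..n} - m\<bar> > t / 2}
        \<le> W * ennreal ((1 + 2 * K) * F)" (is "?p \<le> ?b")
      using m K by (auto simp: distrib_right ennreal_plus distrib_left F_def intro: order_trans add_left_mono)
    define B where "B = {x :: real. \<bar>x - m\<bar> > t / 2}"
    have [measurable]: "B \<in> sets borel"
      unfolding B_def by measurable
    let ?N = "\<lambda>Y. {\<omega> \<in> space M. L2_set (\<lambda>i. Y i \<omega>) {1..n} \<in> B}"
    have NX: "emeasure M (?N X) \<le> ?b"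
      using m' by (simp add: B_def)
    have NX': "emeasure M (?N X') \<le> ?b"
      using NX emeasure_L2_set_indep_copy[OF copy, of B] by simp
    have NM: "?N X \<in> sets M" "?N X' \<in> sets M"
      unfolding L2_set_def
      by (measurable, simp add: indep_copy_measurable[OF copy])+
    have "{\<omega> \<in> space M. \<bar>L2_set (\<lambda>i. X i \<omega>) {1..n} - L2_set (\<lambda>i. X' i \<omega>) {1..n}\<bar> > t} \<subseteq> ?N X \<union> ?N X'"
    proof (intro subsetI)
      fix \<omega>
      assume "\<omega> \<in> {\<omega> \<in> space M. \<bar>L2_set (\<lambda>i. X i \<omega>) {1..n} - L2_set (\<lambda>i. X' i \<omega>) {1..n}\<bar> > t}"
      then have "\<omega> \<in> space M" and "\<bar>L2_set (\<lambda>i. X i \<omega>) {1..n} - L2_set (\<lambda>i. X' i \<omega>) {1..n}\<bar> > t"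
        by blast+
      \<comment> \<open>Triangle inequality through the common centre \<open>m\<close>: two numbers
        within \<open>t / 2\<close> of it differ by at most \<open>t\<close>.\<close>
      moreover from this have "\<bar>L2_set (\<lambda>i. X i \<omega>) {1..n} - m\<bar> > t / 2
          \<or> \<bar>L2_set (\<lambda>i. X' i \<omega>) {1..n} - m\<bar> > t / 2"
        by linarith
      ultimately show "\<omega> \<in> ?N X \<union> ?N X'"
        unfolding B_def by blast
    qed
    then have "emeasure M {\<omega> \<in> space M.
        \<bar>L2_set (\<lambda>i. X i \<omega>) {1..n} - L2_set (\<lambda>i. X' i \<omega>) {1..n}\<bar> > t} \<le> emeasure M (?N X \<union> ?N X')"
      by (intro emeasure_mono sets.Un NM)
    also have "\<dots> \<le> emeasure M (?N X) + emeasure M (?N X')"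
      by (intro emeasure_subadditive NM)
    also have "\<dots> \<le> ?b + ?b"
      by (intro add_mono NX NX')
    also have "\<dots> = W * (ennreal ((1 + 2 * K) * F) + ennreal ((1 + 2 * K) * F))"
      by (simp only: distrib_left)
    also have "\<dots> = W * ennreal ((2 + 4 * K) * F)"
      using K by (subst ennreal_plus[symmetric]) (auto simp: F_def algebra_simps)
    also have "\<dots> = ennreal (2 + 4 * K) * of_nat n * sup_moment M q {1..n} X * ennreal F"
      using K by (simp add: W_def ennreal_mult' F_def mult_ac)
    finally show ?thesis
      by (simp add: F_def)
  qed
  show ?thesis
    \<comment> \<open>The two vectors contribute \<open>1 + 2 * K\<close> each to \<open>C\<close>,
      and \<open>c = 1\<close> suffices.\<close>
    using K bound by (intro exI[of _ "2 + 4 * K"] conjI exI[of _ 1]) auto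
qed

end
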